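(* (i) Let $P_1,P_2\in T$. Then $\mathrm{Sl}(2,k)\cdot P_1=\mathrm{Sl}(2,k)\cdot P_2$ if and only if $I_T(P_1)=I_T(P_2)$. (ii) The map $I_T$ induces a bijection from the space of orbits $Z_\mu/\mathrm{Sl}(2,k)$ onto $k^*/{k^*}^3$. (iii) Let $P\in T$, write $P=\lambda\phi^3$ with $\lambda\in k^*$ and $\phi\in (k^2)^*$, and let $G_P=\{g\in \mathrm{Sl}(2,k): g\cdot P=P\}$ be the isotropy subgroup of $P$. Then $$G_P=\{g\in \mathrm{Sl}(2,k): \exists\, \mu\in k^* \text{ such that } g\cdot\phi=\mu\phi \text{ and } \mu^3=1\}.$$
   Context: $k$ is a field of characteristic different from $2$ and $3$; $x,y$ is the standard coordinate basis of $(k^2)^*$; $S^3((k^2)^* )=\{ax^3+3bx^2y+3cxy^2+dy^3: a,b,c,d\in k\}$ is the space of binary cubics. The group $\mathrm{Sl}(2,k)$ acts on $(k^2)^*$ by transpose inverse, i.e. $\begin{pmatrix}\alpha&\beta\\ \gamma&\delta\end{pmatrix}\cdot x=\delta x-\beta y$ and $\begin{pmatrix}\alpha&\beta\\ \gamma&\delta\end{pmatrix}\cdot y=-\gamma x+\alpha y$, and acts on $S^3((k^2)^* )$ functorially. The moment map is $\mu(ax^3+3bx^2y+3cxy^2+dy^3)=\begin{pmatrix} ad-bc & 2(bd-c^2)\\ 2(b^2-ac) & -(ad-bc)\end{pmatrix}$. $T$ is the set of nonzero binary cubics having a triple root, i.e. those of the form $\lambda\phi^3$ with $\lambda\in k^*$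 and $0\ne\phi\in(k^2)^*$; $Z_\mu$ is the set of nonzero binary cubics $P$ with $\mu(P)=0$; one has $T=Z_\mu$. The map $I_T:T\to k^*/{k^*}^3$ is defined by $I_T(\lambda\phi^3)=[\lambda]$ (it is well defined). In (iii) the letter $\mu$ inside the description of $G_P$ denotes a scalar, not the moment map. *)

theory Defs
  imports
    "HOL-Computational_Algebra.Polynomial"
    "HOL-Analysis.Determinants"
    "HOL-Algebra.Group_Action"
begin

section \<open>The symmetric algebra of the dual plane\<close>

text \<open>
  The symmetric algebra of \<open>(k\<^sup>2)\<^sup>*\<close> is the polynomial ring \<open>k[x,y]\<close>, encoded as
  \<open>k[x][y]\<close>, that is, as the type \<open>'k poly poly\<close> (inner variable \<open>x\<close>, outer variable \<open>y\<close>).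
  The dual space and the space of binary cubics are its parts of degree one and three.
\<close>

definition scal :: "'k::field \<Rightarrow> 'k poly poly"
  where "scal c = [:[:c:]:]"

definition coord_x :: "'k::field poly poly"
  where "coord_x = [:[:0, 1:]:]"

definition coord_y :: "'k::field poly poly"
  where "coord_y = [:0, 1:]"

definition linear_forms :: "'k::field poly poly set"
  where "linear_forms = {scal p * coord_x + scal q * coord_y | p q. True}"

definition cubic :: "'k::field \<Rightarrow> 'k \<Rightarrow> 'k \<Rightarrow> 'k \<Rightarrow> 'k poly poly"
  where "cubic a b c d =
    scal a * coord_x ^ 3 + scal (3 * b) * coord_x ^ 2 * coord_y
    + scal (3 * c) * coord_x * coord_y ^ 2 + scal d * coord_y ^ 3"

definition binary_cubics :: "'k::field poly poly set"
  where "binary_cubics = {cubic a b c d | a b c d. True}"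


section \<open>The action of the special linear group\<close>

definition SL2 :: "('k::field ^ 2 ^ 2) monoid"
  where "SL2 = \<lparr>carrier = {g. det g = 1}, mult = (**), one = mat 1\<rparr>"

text \<open>
  \<open>subst_xy u v\<close> is the \<open>k\<close>-algebra endomorphism of \<open>k[x,y]\<close> with \<open>x \<mapsto> u\<close> and \<open>y \<mapsto> v\<close>.
\<close>

definition subst_xy :: "'k::field poly poly \<Rightarrow> 'k poly poly \<Rightarrow> 'k poly poly \<Rightarrow> 'k poly poly"
  where "subst_xy u v P = poly (map_poly (\<lambda>q. poly (map_poly scal q) u) P) v"

text \<open>
  Functoriality of the symmetric algebra: the transpose inverse action on linear forms,
  given on the basis \<open>x, y\<close>, extends to \<open>k[x,y]\<close> by algebra automorphisms.
\<close>

definition act :: "'k::field ^ 2 ^ 2 \<Rightarrow> 'k poly poly \<Rightarrow> 'k poly poly"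
  where "act g = subst_xy
    (scal (g $ 2 $ 2) * coord_x - scal (g $ 1 $ 2) * coord_y)
    (- scal (g $ 2 $ 1) * coord_x + scal (g $ 1 $ 1) * coord_y)"


section \<open>Moment map and cubics with a triple root\<close>

text \<open>
  The coefficient of \<open>x\<^sup>i y\<^sup>j\<close> in \<open>P\<close> is \<open>coeff (coeff P j) i\<close>; the divisions by \<open>3\<close> undo the
  factors \<open>3\<close> in \<open>cubic\<close>.  The definition is meant for binary cubics in characteristic not \<open>3\<close>
  only, see \<open>moment_map_cubic\<close> below.
\<close>

definition moment_map :: "'k::field poly poly \<Rightarrow> 'k ^ 2 ^ 2"
  where "moment_map P =
    (let a = coeff (coeff P 0) 3;
         b = coeff (coeff P 1) 2 / 3;
         c = coeff (coeff P 2) 1 / 3;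
         d = coeff (coeff P 3) 0
     in vector [vector [a * d - b * c, 2 * (b * d - c\<^sup>2)],
                vector [2 * (b\<^sup>2 - a * c), - (a * d - b * c)]])"

definition Z_mu :: "'k::field poly poly set"
  where "Z_mu = {P \<in> binary_cubics. P \<noteq> 0 \<and> moment_map P = 0}"

definition T :: "'k::field poly poly set"
  where "T = {scal l * \<phi> ^ 3 | l \<phi>. l \<noteq> 0 \<and> \<phi> \<in> linear_forms \<and> \<phi> \<noteq> 0}"


section \<open>The cube class invariant\<close>

definition units_group :: "'k::field monoid"
  where "units_group = \<lparr>carrier = {c. c \<noteq> 0}, mult = (*), one = 1\<rparr>"

definition cubes :: "'k::field set"
  where "cubes = {c ^ 3 | c. c \<noteq> 0}"

definition cube_class :: "'k::field \<Rightarrow> 'k set"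
  where "cube_class l = cubes #>\<^bsub>units_group\<^esub> l"

definition cube_class_group :: "'k::field set monoid"
  where "cube_class_group = units_group Mod cubes"

definition I_T :: "'k::field poly poly \<Rightarrow> 'k set"
  where "I_T P = (THE C. \<exists>l \<phi>. l \<noteq> 0 \<and> \<phi> \<in> linear_forms \<and> \<phi> \<noteq> 0 \<and>
                          P = scal l * \<phi> ^ 3 \<and> C = cube_class l)"


section \<open>Basic facts\<close>

lemma poly_scal_0: "scal 0 = 0"
  by (simp add: scal_def)

lemma scal_hom:
  "scal (a + b) = scal a + scal b" "scal (a * b) = scal a * scal b"
  "scal (- a) = - scal a" "scal (a - b) = scal a - scal b" "scal 1 = 1"
  by (simp_all add: scal_def one_pCons)

lemma map_poly_additive:
  assumes "f 0 = 0" and "\<And>a b. f (a + b) = f a + f b"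
  shows "map_poly f (p + q) = map_poly f p + map_poly f q"
  by (intro poly_eqI) (simp add: coeff_map_poly assms)

lemma poly_map_poly_mult:
  fixes f :: "'a::comm_ring_1 \<Rightarrow> 'b::comm_ring_1"
  assumes f0: "f 0 = 0" and fa: "\<And>a b. f (a + b) = f a + f b"
    and fm: "\<And>a b. f (a * b) = f a * f b"
  shows "poly (map_poly f (p * q)) u = poly (map_poly f p) u * poly (map_poly f q) u"
proof (induction p)
  case 0
  then show ?case by simp
next
  case (pCons a p)
  have "map_poly f (smult a q) = smult (f a) (map_poly f q)"
    by (intro poly_eqI) (simp add: coeff_map_poly f0 fm)
  with pCons show ?case
    by (simp add: map_poly_pCons map_poly_additive f0 fa algebra_simps)
qed

lemma subst_xy_add: "subst_xy u v (P + Q) = subst_xy u v P + subst_xy u v Q"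
  by (simp add: subst_xy_def map_poly_additive poly_scal_0 scal_hom)

lemma subst_xy_mult: "subst_xy u v (P * Q) = subst_xy u v P * subst_xy u v Q"
  unfolding subst_xy_def
  by (rule poly_map_poly_mult)
     (simp_all add: map_poly_additive poly_map_poly_mult poly_scal_0 scal_hom)

lemma subst_xy_gens:
  "subst_xy u v (scal c) = scal c" "subst_xy u v coord_x = u" "subst_xy u v coord_y = v"
  by (simp_all add: subst_xy_def coord_x_def coord_y_def map_poly_pCons poly_scal_0 scal_hom,
      simp_all add: scal_def map_poly_pCons)

lemma act_hom:
  "act g (P + Q) = act g P + act g Q" "act g (P * Q) = act g P * act g Q"
  "act g (scal c) = scal c"
  by (simp_all add: act_def subst_xy_add subst_xy_mult subst_xy_gens)

lemma act_power: "act g (P ^ n) = act g P ^ n"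
  using act_hom(3)[of g 1] by (induction n) (simp_all add: act_hom scal_hom)

lemma act_coord:
  "act g coord_x = scal (g $ 2 $ 2) * coord_x - scal (g $ 1 $ 2) * coord_y"
  "act g coord_y = - scal (g $ 2 $ 1) * coord_x + scal (g $ 1 $ 1) * coord_y"
  by (simp_all add: act_def subst_xy_gens)

lemma coeff_cubic:
  "coeff (coeff (cubic a b c d) 0) 3 = a" "coeff (coeff (cubic a b c d) 1) 2 = 3 * b"
  "coeff (coeff (cubic a b c d) 2) 1 = 3 * c" "coeff (coeff (cubic a b c d) 3) 0 = d"
  by (simp_all add: cubic_def scal_def coord_x_def coord_y_def power2_eq_square power3_eq_cube
      numeral_eq_Suc)

lemma moment_map_cubic:
  assumes "(3::'k::field) \<noteq> 0"
  shows "moment_map (cubic a b c (d::'k)) =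
    vector [vector [a * d - b * c, 2 * (b * d - c\<^sup>2)],
            vector [2 * (b\<^sup>2 - a * c), - (a * d - b * c)]]"
  using assms unfolding moment_map_def coeff_cubic by (simp add: Let_def)

lemma linear_cube:
  "scal l * (scal p * coord_x + scal q * coord_y) ^ 3
   = cubic (l * p ^ 3) (l * p\<^sup>2 * q) (l * p * q\<^sup>2) (l * q ^ 3)"
proof -
  have "scal 3 = (3 :: 'a poly poly)"
    by (simp add: scal_def numeral_poly)
  then show ?thesis
    unfolding cubic_def power2_eq_square power3_eq_cube scal_hom by (simp add: algebra_simps)
qed

lemma cube_class_scale:
  assumes "(r::'k::field) \<noteq> 0"
  shows "cube_class (l * r ^ 3) = cube_class l"
proof -
  have *: "\<exists>c'. c ^ 3 * (l * r ^ 3) = c' ^ 3 * l \<and> c' \<noteq> 0" if "c \<noteq> 0" for c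
    using that assms by (intro exI[of _ "c * r"]) (simp add: power_mult_distrib)
  have **: "\<exists>c'. c ^ 3 * l = c' ^ 3 * (l * r ^ 3) \<and> c' \<noteq> 0" if "c \<noteq> 0" for c
    using that assms by (intro exI[of _ "c / r"]) (simp add: power_divide)
  have "cube_class m = {c ^ 3 * m | c. c \<noteq> 0}" for m :: 'k
    by (auto simp: cube_class_def cubes_def units_group_def r_coset_def)
  with * ** show ?thesis
    by fastforce
qed

text \<open>Well-definedness of \<open>I_T\<close>.\<close>

lemma I_T_eq:
  fixes l :: "'k::field"
  assumes "(3::'k) \<noteq> 0" and l: "l \<noteq> 0" and \<phi>: "\<phi> \<in> linear_forms" "\<phi> \<noteq> 0"
  shows "I_T (scal l * \<phi> ^ 3) = cube_class l"
  unfolding I_T_def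
proof (rule the_equality)
  show "\<exists>m \<psi>. m \<noteq> 0 \<and> \<psi> \<in> linear_forms \<and> \<psi> \<noteq> 0 \<and>
      scal l * \<phi> ^ 3 = scal m * \<psi> ^ 3 \<and> cube_class l = cube_class m"
    using l \<phi> by blast
next
  fix C
  assume "\<exists>m \<psi>. m \<noteq> 0 \<and> \<psi> \<in> linear_forms \<and> \<psi> \<noteq> 0 \<and>
      scal l * \<phi> ^ 3 = scal m * \<psi> ^ 3 \<and> C = cube_class m"
  then obtain m \<psi> where m: "m \<noteq> 0" and \<psi>: "\<psi> \<in> linear_forms" "\<psi> \<noteq> 0"
    and eq: "scal l * \<phi> ^ 3 = scal m * \<psi> ^ 3" and C: "C = cube_class m"
    by blast
  obtain p q where pq: "\<phi> = scal p * coord_x + scal q * coord_y"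
    using \<phi>(1) by (auto simp: linear_forms_def)
  obtain r s where rs: "\<psi> = scal r * coord_x + scal s * coord_y"
    using \<psi>(1) by (auto simp: linear_forms_def)
  have "p \<noteq> 0 \<or> q \<noteq> 0"
    using \<phi>(2) by (auto simp: pq poly_scal_0)
  moreover have e: "l * p ^ 3 = m * r ^ 3" "l * q ^ 3 = m * s ^ 3"
    using eq unfolding pq rs linear_cube by (metis coeff_cubic(1), metis coeff_cubic(4))
  ultimately obtain u v where "u \<noteq> 0" "l * u ^ 3 = m * v ^ 3"
    by blast
  moreover from this have "v \<noteq> 0"
    using l by auto
  ultimately show "C = cube_class l"
    using C cube_class_scale by metis
qed

end

theory Submission
  imports Defs
begin

text \<open>
  Everything rests on one description of orbits: the group \<open>SL(2,k)\<close> acts transitively on the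
  nonzero linear forms (\<open>act_transitive\<close>), and \<open>g \<cdot> (\<lambda>\<phi>\<^sup>3) = \<lambda>(g \<cdot> \<phi>)\<^sup>3\<close> because \<open>g\<close> acts by algebra
  automorphisms.  Hence the orbit of \<open>\<lambda>\<phi>\<^sup>3\<close> is the set of all \<open>\<lambda>\<psi>\<^sup>3\<close> with \<open>\<psi>\<close> a nonzero linear form
  (\<open>orbit_scaled_cube\<close>), which depends on \<open>\<lambda>\<close> alone.  Replacing \<open>\<psi>\<close> by \<open>r\<psi>\<close> shows that it depends
  only on the class of \<open>\<lambda>\<close> modulo cubes, and since \<open>I_T\<close> is well defined, the
  class can be recovered from any member of the orbit (\<open>scaled_cubes_eq_iff\<close>).  This is the
  classification of the orbits in \<open>T\<close>.

  It carries over to the null set of the moment map because \<open>\<mu>(P) = 0\<close> says that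
  \<open>ad = bc\<close>, \<open>bd = c\<^sup>2\<close> and \<open>b\<^sup>2 = ac\<close>: the coefficients \<open>(a, b, c, d)\<close> form a geometric progression,
  so that \<open>P = a(x + (b/a)y)\<^sup>3\<close> if \<open>a \<noteq> 0\<close>, and \<open>P = dy\<^sup>3\<close> otherwise (\<open>Z_mu_eq_T\<close>).

  For the isotropy group, \<open>g\<close> fixes \<open>\<lambda>\<phi>\<^sup>3\<close> exactly when \<open>(g \<cdot> \<phi>)\<^sup>3 = \<phi>\<^sup>3\<close>, and two linear forms with
  the same cube differ by a cube root of unity in \<open>k\<close> (\<open>linear_form_cube_eq_iff\<close>).
\<close>

section \<open>Linear forms and their cubes\<close>

abbreviation linear_form :: "'k::field \<Rightarrow> 'k \<Rightarrow> 'k poly poly"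
  where "linear_form p q \<equiv> scal p * coord_x + scal q * coord_y"

lemma linear_form_eq_iff:
  "linear_form p q = linear_form r s \<longleftrightarrow> p = r \<and> q = s"
  by (simp add: scal_def coord_x_def coord_y_def)

lemma linear_form_eq_0_iff: "linear_form p q = 0 \<longleftrightarrow> p = 0 \<and> q = 0"
  using linear_form_eq_iff[of p q 0 0] by (simp add: poly_scal_0)

lemma scal_eq_0_iff: "scal l = 0 \<longleftrightarrow> l = 0"
  by (simp add: scal_def)

lemma scal_power: "scal (m ^ n) = scal m ^ n"
  by (induction n) (simp_all add: scal_hom)

lemma linear_forms_scale:
  assumes "\<phi> \<in> linear_forms"
  shows "scal m * \<phi> \<in> linear_forms"
proof -
  obtain p q where "\<phi> = linear_form p q"
    using assms by (auto simp: linear_forms_def)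
  then have "scal m * \<phi> = linear_form (m * p) (m * q)"
    by (simp add: scal_hom algebra_simps)
  then show ?thesis
    by (auto simp: linear_forms_def)
qed

lemma cubic_eq_iff:
  assumes "(3::'k::field) \<noteq> 0"
  shows "cubic a b c (d::'k) = cubic a' b' c' d' \<longleftrightarrow> a = a' \<and> b = b' \<and> c = c' \<and> d = d'"
  by (metis assms coeff_cubic mult_cancel_left)

text \<open>
  The ratio of the two forms can be read off at a nonzero coefficient of \<open>\<phi>\<close>.  The mixed
  coefficients \<open>p\<^sup>2 q\<close> and \<open>p q\<^sup>2\<close> of the cube force the other coefficient to have the same ratio; the
  outer coefficients alone would leave two unrelated cube roots of unity.
\<close>

lemma linear_form_cube_eq_iff:
  fixes \<phi> \<psi> :: "'k::field poly poly"
  assumes three: "(3::'k) \<noteq> 0"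
    and \<phi>: "\<phi> \<in> linear_forms" "\<phi> \<noteq> 0" and \<psi>: "\<psi> \<in> linear_forms"
  shows "\<psi> ^ 3 = \<phi> ^ 3 \<longleftrightarrow> (\<exists>m. m \<noteq> 0 \<and> \<psi> = scal m * \<phi> \<and> m ^ 3 = 1)"
proof
  assume eq: "\<psi> ^ 3 = \<phi> ^ 3"
  obtain p q where pq: "\<phi> = linear_form p q"
    using \<phi>(1) by (auto simp: linear_forms_def)
  obtain r s where rs: "\<psi> = linear_form r s"
    using \<psi> by (auto simp: linear_forms_def)
  have "cubic (r ^ 3) (r\<^sup>2 * s) (r * s\<^sup>2) (s ^ 3) = cubic (p ^ 3) (p\<^sup>2 * q) (p * q\<^sup>2) (q ^ 3)"
    using eq linear_cube[of 1 r s] linear_cube[of 1 p q] by (simp add: pq rs scal_hom)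
  then have e: "r ^ 3 = p ^ 3" "r\<^sup>2 * s = p\<^sup>2 * q" "r * s\<^sup>2 = p * q\<^sup>2" "s ^ 3 = q ^ 3"
    by (simp_all add: cubic_eq_iff[OF three])
  have ratio: "\<exists>m. r = m * p \<and> s = m * q \<and> m ^ 3 = 1"
    if "p \<noteq> 0" "r ^ 3 = p ^ 3" "r\<^sup>2 * s = p\<^sup>2 * q" for p q r s :: 'k
  proof (intro exI conjI)
    have "r \<noteq> 0"
      using that by auto
    show "r = r / p * p"
      using that by simp
    show "(r / p) ^ 3 = 1"
      using that by (simp add: power_divide)
    have "r\<^sup>2 * (p * s) = p ^ 3 * q"
      using that(3) by (simp add: power2_eq_square power3_eq_cube algebra_simps)
    also have "\<dots> = r\<^sup>2 * (r * q)"
      using that(2)[symmetric] by (simp add: power2_eq_square power3_eq_cube)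
    finally show "s = r / p * q"
      using \<open>r \<noteq> 0\<close> \<open>p \<noteq> 0\<close> by (simp add: field_simps)
  qed
  have "p \<noteq> 0 \<or> q \<noteq> 0"
    using \<phi>(2) by (simp add: pq linear_form_eq_0_iff)
  then obtain m where m: "r = m * p" "s = m * q" "m ^ 3 = 1"
    using ratio[of p r s q] ratio[of q s r p] e by (auto simp: mult.commute)
  moreover have "m \<noteq> 0"
    using m(3) by auto
  ultimately show "\<exists>m. m \<noteq> 0 \<and> \<psi> = scal m * \<phi> \<and> m ^ 3 = 1"
    by (intro exI[of _ m]) (simp add: pq rs scal_hom algebra_simps)
next
  assume "\<exists>m. m \<noteq> 0 \<and> \<psi> = scal m * \<phi> \<and> m ^ 3 = 1"
  then show "\<psi> ^ 3 = \<phi> ^ 3"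
    by (metis power_mult_distrib scal_power scal_hom(5) mult_1)
qed


section \<open>Cubics with a triple root are the zeros of the moment map\<close>

lemma moment_map_cubic_eq_0_iff:
  assumes "(2::'k::field) \<noteq> 0" "(3::'k) \<noteq> 0"
  shows "moment_map (cubic a b c (d::'k)) = 0 \<longleftrightarrow> a * d = b * c \<and> b * d = c\<^sup>2 \<and> b\<^sup>2 = a * c"
  using assms by (auto simp: moment_map_cubic vec_eq_iff forall_2 vector_2)

lemma Z_mu_eq_T:
  assumes two: "(2::'k::field) \<noteq> 0" and three: "(3::'k) \<noteq> 0"
  shows "(Z_mu :: 'k poly poly set) = T"
proof (intro equalityI subsetI)
  fix P :: "'k poly poly"
  assume "P \<in> Z_mu"
  then obtain a b c d where P: "P = cubic a b c d" "P \<noteq> 0" "moment_map P = 0"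
    by (auto simp: Z_mu_def binary_cubics_def)
  have rel: "a * d = b * c" "b * d = c\<^sup>2" "b\<^sup>2 = a * c"
    using P(3) by (simp_all add: P(1) moment_map_cubic_eq_0_iff[OF two three])
  obtain l p q where lpq: "P = scal l * linear_form p q ^ 3"
  proof (cases "a = 0")
    case True
    with rel have "b = 0" "c = 0"
      by auto
    with True have "P = scal d * linear_form 0 1 ^ 3"
      by (simp only: P(1) linear_cube) simp
    then show ?thesis
      using that by blast
  next
    case False
    have "c = a * (b / a)\<^sup>2"
      using False rel(3) by (simp add: field_simps power2_eq_square)
    moreover have "d = a * (b / a) ^ 3"
    proof -
      have "a\<^sup>2 * d = b ^ 3"
        using rel by (simp add: power2_eq_square power3_eq_cube algebra_simps)
      then show ?thesis
        using False by (simp add: field_simps power2_eq_square power3_eq_cube)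
    qed
    ultimately have "P = scal a * linear_form 1 (b / a) ^ 3"
      using False by (simp add: P(1) linear_cube)
    then show ?thesis
      using that by blast
  qed
  moreover have "l \<noteq> 0" "linear_form p q \<noteq> 0"
    using P(2) lpq by (auto simp: poly_scal_0)
  ultimately show "P \<in> T"
    unfolding T_def linear_forms_def by blast
next
  fix P :: "'k poly poly"
  assume "P \<in> T"
  then obtain l p q where P: "P = scal l * linear_form p q ^ 3"
    and nz: "l \<noteq> 0" "linear_form p q \<noteq> 0"
    by (auto simp: T_def linear_forms_def)
  have "P \<noteq> 0"
    using nz by (simp add: P scal_eq_0_iff)
  moreover have "P \<in> binary_cubics"
    by (auto simp: P linear_cube binary_cubics_def)
  moreover have "moment_map P = 0"
    unfolding P linear_cube moment_map_cubic_eq_0_iff[OF two three]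
    by (simp add: power2_eq_square power3_eq_cube)
  ultimately show "P \<in> Z_mu"
    by (simp add: Z_mu_def)
qed


section \<open>Orbits in the cone of triple roots\<close>

lemma act_linear_form:
  "act g (linear_form p q)
   = linear_form (p * g $ 2 $ 2 - q * g $ 2 $ 1) (q * g $ 1 $ 1 - p * g $ 1 $ 2)"
  by (simp add: act_hom act_coord scal_hom algebra_simps)

lemma act_linear_forms:
  assumes "\<phi> \<in> linear_forms"
  shows "act g \<phi> \<in> linear_forms"
  using assms act_linear_form by (fastforce simp: linear_forms_def)

lemma act_linear_form_neq_0:
  assumes g: "det g = (1::'k::field)" and \<phi>: "\<phi> \<in> linear_forms" "\<phi> \<noteq> 0"
  shows "act g \<phi> \<noteq> 0"
proof
  assume zero: "act g \<phi> = 0"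
  obtain p q where pq: "\<phi> = linear_form p q"
    using \<phi>(1) by (auto simp: linear_forms_def)
  have e: "p * g $ 2 $ 2 = q * g $ 2 $ 1" "q * g $ 1 $ 1 = p * g $ 1 $ 2"
    using zero by (simp_all add: pq act_linear_form linear_form_eq_0_iff)
  have "g $ 1 $ 1 * g $ 2 $ 2 - g $ 1 $ 2 * g $ 2 $ 1 = 1"
    using g by (simp add: det_2)
  \<comment> \<open>The adjugate matrix recovers \<open>p\<close> and \<open>q\<close> from the coefficients of \<open>act g \<phi>\<close>.\<close>
  with e have "p = 0" "q = 0"
    by algebra+
  with \<phi>(2) show False
    by (simp add: pq poly_scal_0)
qed

text \<open>
  Sending \<open>px + qy\<close> to \<open>rx + sy\<close> imposes two linear conditions on the matrix.  If \<open>p \<noteq> 0\<close> they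
  determine the second column from the first one \<open>(\<alpha>, \<gamma>)\<close>, and the determinant becomes
  \<open>(\<alpha>r + \<gamma>s)/p\<close>, which takes the value \<open>1\<close> for a suitable first column as \<open>(r, s) \<noteq> 0\<close>.  If \<open>p = 0\<close>,
  then \<open>q \<noteq> 0\<close> and the columns exchange roles.
\<close>

lemma act_transitive:
  fixes \<phi> \<psi> :: "'k::field poly poly"
  assumes \<phi>: "\<phi> \<in> linear_forms" "\<phi> \<noteq> 0" and \<psi>: "\<psi> \<in> linear_forms" "\<psi> \<noteq> 0"
  obtains g where "det g = 1" "act g \<phi> = \<psi>"
proof -
  obtain p q where pq: "\<phi> = linear_form p q"
    using \<phi>(1) by (auto simp: linear_forms_def)
  obtain r s where rs: "\<psi> = linear_form r s"
    using \<psi>(1) by (auto simp: linear_forms_def)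
  have "p \<noteq> 0 \<or> q \<noteq> 0" "r \<noteq> 0 \<or> s \<noteq> 0"
    using \<phi>(2) \<psi>(2) by (simp_all add: pq rs linear_form_eq_0_iff)
  then have solvable: "\<exists>u v. u * r + v * s = t" for t
    by (metis add.right_neutral add_0 mult_zero_left nonzero_eq_divide_eq)
  have "\<exists>\<alpha> \<beta> \<gamma> \<delta>. \<alpha> * \<delta> - \<beta> * \<gamma> = 1 \<and> p * \<delta> - q * \<gamma> = r \<and> q * \<alpha> - p * \<beta> = s"
  proof (cases "p = 0")
    case False
    obtain \<alpha> \<gamma> where ag: "\<alpha> * r + \<gamma> * s = p"
      using solvable by blast
    define \<beta> \<delta> where "\<beta> = (q * \<alpha> - s) / p" and "\<delta> = (r + q * \<gamma>) / p"
    have bd: "p * \<beta> = q * \<alpha> - s" "p * \<delta> = r + q * \<gamma>"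
      using False by (simp_all add: \<beta>_def \<delta>_def)
    have "p * (\<alpha> * \<delta> - \<beta> * \<gamma>) = \<alpha> * (p * \<delta>) - p * \<beta> * \<gamma>"
      by (simp add: algebra_simps)
    also have "\<dots> = p * 1"
      unfolding bd using ag by (simp add: algebra_simps)
    finally have "p * (\<alpha> * \<delta> - \<beta> * \<gamma>) = p * 1" .
    with False have "\<alpha> * \<delta> - \<beta> * \<gamma> = 1"
      by (simp only: mult_cancel_left) simp
    with bd show ?thesis
      by (intro exI[of _ \<alpha>] exI[of _ \<beta>] exI[of _ \<gamma>] exI[of _ \<delta>]) simp
  next
    case True
    with \<open>p \<noteq> 0 \<or> q \<noteq> 0\<close> have "q \<noteq> 0"
      by simp
    obtain \<beta> \<delta> where bd: "\<beta> * r + \<delta> * s = q"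
      using solvable by blast
    define \<alpha> \<gamma> where "\<alpha> = s / q" and "\<gamma> = - r / q"
    have ag: "q * \<alpha> = s" "q * \<gamma> = - r"
      using \<open>q \<noteq> 0\<close> by (simp_all add: \<alpha>_def \<gamma>_def)
    have "q * (\<alpha> * \<delta> - \<beta> * \<gamma>) = q * \<alpha> * \<delta> - \<beta> * (q * \<gamma>)"
      by (simp add: algebra_simps)
    also have "\<dots> = q * 1"
      unfolding ag using bd by (simp add: algebra_simps)
    finally have "q * (\<alpha> * \<delta> - \<beta> * \<gamma>) = q * 1" .
    with \<open>q \<noteq> 0\<close> have "\<alpha> * \<delta> - \<beta> * \<gamma> = 1"
      by (simp only: mult_cancel_left) simp
    with ag True show ?thesis
      by (intro exI[of _ \<alpha>] exI[of _ \<beta>] exI[of _ \<gamma>] exI[of _ \<delta>]) simp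
  qed
  then obtain \<alpha> \<beta> \<gamma> \<delta>
    where "\<alpha> * \<delta> - \<beta> * \<gamma> = 1" "p * \<delta> - q * \<gamma> = r" "q * \<alpha> - p * \<beta> = s"
    by blast
  then show thesis
    by (intro that[of "vector [vector [\<alpha>, \<beta>], vector [\<gamma>, \<delta>]]"])
       (simp_all add: det_2 pq rs act_linear_form)
qed

definition scaled_cubes :: "'k::field \<Rightarrow> 'k poly poly set"
  where "scaled_cubes l = {scal l * \<psi> ^ 3 | \<psi>. \<psi> \<in> linear_forms \<and> \<psi> \<noteq> 0}"

lemma orbit_scaled_cube:
  fixes \<phi> :: "'k::field poly poly"
  assumes \<phi>: "\<phi> \<in> linear_forms" "\<phi> \<noteq> 0"
  shows "orbit SL2 act (scal l * \<phi> ^ 3) = scaled_cubes l"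
proof -
  have "{act g \<phi> | g. det g = 1} = {\<psi> \<in> linear_forms. \<psi> \<noteq> 0}"
  proof (intro equalityI subsetI)
    fix \<psi> :: "'k poly poly"
    assume "\<psi> \<in> {act g \<phi> | g. det g = 1}"
    then show "\<psi> \<in> {\<psi> \<in> linear_forms. \<psi> \<noteq> 0}"
      using act_linear_forms[OF \<phi>(1)] act_linear_form_neq_0[OF _ \<phi>] by auto
  next
    fix \<psi> :: "'k poly poly"
    assume "\<psi> \<in> {\<psi> \<in> linear_forms. \<psi> \<noteq> 0}"
    then obtain g where "det g = 1" "act g \<phi> = \<psi>"
      using act_transitive[OF \<phi>, of \<psi>] by auto
    then show "\<psi> \<in> {act g \<phi> | g. det g = 1}"
      by auto
  qed
  moreover have "orbit SL2 act (scal l * \<phi> ^ 3)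
      = (\<lambda>\<psi>. scal l * \<psi> ^ 3) ` {act g \<phi> | g. det g = 1}"
    by (auto simp: orbit_def SL2_def act_hom act_power)
  moreover have "scaled_cubes l = (\<lambda>\<psi>. scal l * \<psi> ^ 3) ` {\<psi> \<in> linear_forms. \<psi> \<noteq> 0}"
    by (auto simp: scaled_cubes_def)
  ultimately show ?thesis
    by simp
qed

lemma cube_class_eq: "cube_class l = {c ^ 3 * l | c. c \<noteq> 0}"
  by (auto simp: cube_class_def cubes_def units_group_def r_coset_def)

lemma coord_x_linear_form: "coord_x \<in> linear_forms" "coord_x \<noteq> 0"
proof -
  have "coord_x = linear_form 1 0"
    by (simp add: poly_scal_0 scal_hom)
  then show "coord_x \<in> linear_forms"
    unfolding linear_forms_def by blast
  show "coord_x \<noteq> 0"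
    by (simp add: coord_x_def)
qed

lemma I_T_scaled_cubes:
  assumes "(3::'k::field) \<noteq> 0" "(l::'k) \<noteq> 0"
  shows "I_T ` scaled_cubes l = {cube_class l}"
  using I_T_eq[OF assms] coord_x_linear_form by (auto simp: scaled_cubes_def image_def)

lemma scaled_cubes_subset:
  assumes "r \<noteq> 0"
  shows "scaled_cubes (r ^ 3 * l) \<subseteq> scaled_cubes l"
proof
  fix P
  assume "P \<in> scaled_cubes (r ^ 3 * l)"
  then obtain \<psi> where \<psi>: "\<psi> \<in> linear_forms" "\<psi> \<noteq> 0" "P = scal (r ^ 3 * l) * \<psi> ^ 3"
    by (auto simp: scaled_cubes_def)
  have "P = scal l * (scal r * \<psi>) ^ 3"
    by (simp add: \<psi>(3) scal_hom scal_power power_mult_distrib)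
  moreover have "scal r * \<psi> \<noteq> 0"
    using assms \<psi>(2) by (simp add: scal_eq_0_iff)
  ultimately show "P \<in> scaled_cubes l"
    using linear_forms_scale[OF \<psi>(1)] unfolding scaled_cubes_def by blast
qed

lemma scaled_cubes_eq_iff:
  assumes three: "(3::'k::field) \<noteq> 0" and nz: "(l::'k) \<noteq> 0" "m \<noteq> 0"
  shows "scaled_cubes l = scaled_cubes m \<longleftrightarrow> cube_class l = cube_class m"
proof
  assume "scaled_cubes l = scaled_cubes m"
  then show "cube_class l = cube_class m"
    using I_T_scaled_cubes[OF three] nz by (metis singleton_inject)
next
  have sub: "scaled_cubes l \<subseteq> scaled_cubes m" if "cube_class l = cube_class m" for l m :: 'k
  proof -
    have "l \<in> cube_class l"
      by (auto simp: cube_class_eq intro!: exI[of _ 1])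
    with that obtain r where "r \<noteq> 0" "l = r ^ 3 * m"
      by (auto simp: cube_class_eq)
    then show ?thesis
      using scaled_cubes_subset by blast
  qed
  assume "cube_class l = cube_class m"
  then show "scaled_cubes l = scaled_cubes m"
    using sub[of l m] sub[of m l] by auto
qed

lemma carrier_cube_class_group:
  "carrier cube_class_group = {cube_class l | l. l \<noteq> 0}"
  by (auto simp: cube_class_group_def FactGroup_def RCOSETS_def cube_class_def units_group_def)

lemma orbits_T: "orbits SL2 T act = {scaled_cubes l | l. l \<noteq> 0}"
proof (intro equalityI subsetI)
  fix C :: "'k::field poly poly set"
  assume "C \<in> orbits SL2 T act"
  then show "C \<in> {scaled_cubes l | l. l \<noteq> 0}"
    by (auto simp: orbits_def T_def orbit_scaled_cube)
next
  fix C :: "'k::field poly poly set"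
  assume "C \<in> {scaled_cubes l | l. l \<noteq> 0}"
  then obtain l where l: "l \<noteq> 0" "C = scaled_cubes l"
    by blast
  have "scal l * coord_x ^ 3 \<in> T"
    using l(1) coord_x_linear_form unfolding T_def by blast
  moreover have "C = orbit SL2 act (scal l * coord_x ^ 3)"
    by (simp add: l(2) orbit_scaled_cube coord_x_linear_form)
  ultimately show "C \<in> orbits SL2 T act"
    unfolding orbits_def by blast
qed

text \<open>
  Since \<open>I_T\<close> is constant on an orbit, the induced map sends an orbit to the only element of its
  image under \<open>I_T\<close>.
\<close>

lemma bij_betw_orbits_cube_classes:
  assumes three: "(3::'k::field) \<noteq> 0"
  shows "bij_betw (\<lambda>C. the_elem (I_T ` C)) (orbits SL2 (T :: 'k poly poly set) act)
    (carrier cube_class_group)"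
proof (rule bij_betwI')
  fix C D :: "'k poly poly set"
  assume "C \<in> orbits SL2 T act" "D \<in> orbits SL2 T act"
  then obtain l m where "l \<noteq> 0" "C = scaled_cubes l" "m \<noteq> 0" "D = scaled_cubes m"
    unfolding orbits_T by blast
  then show "the_elem (I_T ` C) = the_elem (I_T ` D) \<longleftrightarrow> C = D"
    by (simp add: I_T_scaled_cubes[OF three] scaled_cubes_eq_iff[OF three])
next
  fix C :: "'k poly poly set"
  assume "C \<in> orbits SL2 T act"
  then obtain l where "l \<noteq> 0" "C = scaled_cubes l"
    unfolding orbits_T by blast
  then have "the_elem (I_T ` C) = cube_class l"
    by (simp add: I_T_scaled_cubes[OF three])
  with \<open>l \<noteq> 0\<close> show "the_elem (I_T ` C) \<in> carrier cube_class_group"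
    unfolding carrier_cube_class_group by blast
next
  fix K :: "'k set"
  assume "K \<in> carrier cube_class_group"
  then obtain l where l: "l \<noteq> 0" "K = cube_class l"
    unfolding carrier_cube_class_group by blast
  then have "K = the_elem (I_T ` scaled_cubes l)"
    by (simp add: I_T_scaled_cubes[OF three])
  with l(1) show "\<exists>C \<in> orbits SL2 T act. K = the_elem (I_T ` C)"
    unfolding orbits_T by blast
qed


section \<open>Classification of the orbits and their isotropy groups\<close>

lemma of_nat_prime_neq_0_if_CHAR_neq:
  assumes "prime n" "CHAR('k::field) \<noteq> n"
  shows "(of_nat n :: 'k) \<noteq> 0"
proof
  assume "(of_nat n :: 'k) = 0"
  then have "CHAR('k) dvd n"
    by (simp add: of_nat_eq_0_iff_char_dvd)
  with assms show False
    using CHAR_not_1[where 'a = 'k] by (auto simp: prime_nat_iff)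
qed

theorem proposition3p6:
  assumes char: "CHAR('k::field) \<noteq> 2" "CHAR('k) \<noteq> 3"
  shows
    "(\<forall>P1 \<in> (T :: 'k poly poly set). \<forall>P2 \<in> T.
        orbit SL2 act P1 = orbit SL2 act P2 \<longleftrightarrow> I_T P1 = I_T P2)
     \<and>
     (\<exists>I :: 'k poly poly set \<Rightarrow> 'k set.
        (\<forall>P \<in> Z_mu. I (orbit SL2 act P) = I_T P) \<and>
        bij_betw I (orbits SL2 Z_mu act) (carrier cube_class_group))
     \<and>
     (\<forall>P \<in> (T :: 'k poly poly set). \<forall>l \<phi>.
        l \<noteq> 0 \<and> \<phi> \<in> linear_forms \<and> P = scal l * \<phi> ^ 3 \<longrightarrow>
        stabilizer SL2 act P =
          {g \<in> carrier SL2. \<exists>m. m \<noteq> 0 \<and> act g \<phi> = scal m * \<phi> \<and> m ^ 3 = 1})"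
proof (intro conjI)
  have two: "(2::'k) \<noteq> 0" and three: "(3::'k) \<noteq> 0"
    using of_nat_prime_neq_0_if_CHAR_neq[where 'k = 'k, of 2]
      of_nat_prime_neq_0_if_CHAR_neq[where 'k = 'k, of 3] char by simp_all
  have orbit_T: "\<exists>l. l \<noteq> 0 \<and> orbit SL2 act P = scaled_cubes l \<and> I_T P = cube_class l"
    if in_T: "P \<in> T" for P :: "'k poly poly"
  proof -
    obtain l \<phi> where l: "l \<noteq> 0" and \<phi>: "\<phi> \<in> linear_forms" "\<phi> \<noteq> 0"
      and P: "P = scal l * \<phi> ^ 3"
      using in_T unfolding T_def by blast
    show ?thesis
      unfolding P using l orbit_scaled_cube[OF \<phi>] I_T_eq[OF three l \<phi>]
      by (intro exI[of _ l]) simp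
  qed
  show "\<forall>P1 \<in> (T :: 'k poly poly set). \<forall>P2 \<in> T.
      orbit SL2 act P1 = orbit SL2 act P2 \<longleftrightarrow> I_T P1 = I_T P2"
  proof (intro ballI)
    fix P1 P2 :: "'k poly poly"
    assume "P1 \<in> T" "P2 \<in> T"
    then obtain l1 l2
      where "l1 \<noteq> 0" "orbit SL2 act P1 = scaled_cubes l1" "I_T P1 = cube_class l1"
        and "l2 \<noteq> 0" "orbit SL2 act P2 = scaled_cubes l2" "I_T P2 = cube_class l2"
      using orbit_T[of P1] orbit_T[of P2] by metis
    then show "orbit SL2 act P1 = orbit SL2 act P2 \<longleftrightarrow> I_T P1 = I_T P2"
      using scaled_cubes_eq_iff[OF three, of l1 l2] by simp
  qed
  show "\<exists>I :: 'k poly poly set \<Rightarrow> 'k set.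
      (\<forall>P \<in> Z_mu. I (orbit SL2 act P) = I_T P) \<and>
      bij_betw I (orbits SL2 Z_mu act) (carrier cube_class_group)"
  proof (intro exI conjI)
    show "\<forall>P \<in> (Z_mu :: 'k poly poly set). the_elem (I_T ` orbit SL2 act P) = I_T P"
      unfolding Z_mu_eq_T[OF two three]
    proof
      fix P :: "'k poly poly"
      assume "P \<in> T"
      then obtain l
        where "l \<noteq> 0" "orbit SL2 act P = scaled_cubes l" "I_T P = cube_class l"
        using orbit_T by metis
      then show "the_elem (I_T ` orbit SL2 act P) = I_T P"
        using I_T_scaled_cubes[OF three, of l] by simp
    qed
    show "bij_betw (\<lambda>C. the_elem (I_T ` C)) (orbits SL2 (Z_mu :: 'k poly poly set) act)
        (carrier cube_class_group)"
      unfolding Z_mu_eq_T[OF two three] by (rule bij_betw_orbits_cube_classes[OF three])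
  qed
  show "\<forall>P \<in> (T :: 'k poly poly set). \<forall>l \<phi>.
      l \<noteq> 0 \<and> \<phi> \<in> linear_forms \<and> P = scal l * \<phi> ^ 3 \<longrightarrow>
      stabilizer SL2 act P =
        {g \<in> carrier SL2. \<exists>m. m \<noteq> 0 \<and> act g \<phi> = scal m * \<phi> \<and> m ^ 3 = 1}"
  proof (intro ballI allI impI, elim conjE)
    fix P :: "'k poly poly" and l \<phi>
    assume "P \<in> T" and l: "l \<noteq> 0" and \<phi>: "\<phi> \<in> linear_forms" and P: "P = scal l * \<phi> ^ 3"
    have "P \<noteq> 0"
      using \<open>P \<in> T\<close> by (auto simp: T_def scal_eq_0_iff)
    then have "\<phi> \<noteq> 0"
      by (auto simp: P)
    have "act g P = P \<longleftrightarrow> act g \<phi> ^ 3 = \<phi> ^ 3" for g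
      using l by (simp add: P act_hom act_power scal_eq_0_iff)
    then show "stabilizer SL2 act P =
        {g \<in> carrier SL2. \<exists>m. m \<noteq> 0 \<and> act g \<phi> = scal m * \<phi> \<and> m ^ 3 = 1}"
      using linear_form_cube_eq_iff[OF three \<phi> \<open>\<phi> \<noteq> 0\<close> act_linear_forms[OF \<phi>]]
      by (simp add: stabilizer_def)
  qed
qed

end
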